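(* Let $A\in\mathbb{R}^{n\times n}$ be invertible and symmetric, with distinct eigenvalues $a_1,\dots,a_p$ and, for each $i$, orthonormal eigenvectors $u_{i,1},\dots,u_{i,n_i}$ associated with $a_i$, where $\sum_{i=1}^p n_i=n$. Consider the nonlinear eigenvalue problem $\mathcal{I}_2(u)u=\lambda u$. (a) If $A$ is definite, then all the eigenvectors associated with nonzero eigenvalue are given by $$(\ast)\qquad u^*=\sum_{s=1}^{n_{i_1}}c_{i_1,s}u_{i_1,s}+\sum_{r=1}^{n_{i_2}}c_{i_2,r}u_{i_2,r},\qquad i_1\neq i_2,\ i_1,i_2\in\{1,\dots,p\},$$ where at least one term in $\{c_{i_1,s}\}_{s=1}^{n_{i_1}}$ is nonzero, at least one term in $\{c_{i_2,r}\}_{r=1}^{n_{i_2}}$ is nonzero, and $$\frac{c_{i_2}^2}{c_{i_1}^2}=\frac{a_{i_1}}{a_{i_2}}>0\quad\text{with}\quad c_{i_1}^2=\sum_{s=1}^{n_{i_1}}c_{i_1,s}^2,\quad c_{i_2}^2=\sum_{r=1}^{n_{i_2}}c_{i_2,r}^2 .$$ (b) If $A$ is indefinite, then all the eigenvectors associated with non-unit eigenvalues (eigenvalues different from $1$) are given by $(\ast)$, and the eigenvectors associated with eigenvalue one are given by $u^*$, where $\langle Au^*,u^*\rangle=0$.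
   Context: $\langle\cdot,\cdot\rangle$ is the Euclidean inner product. For $0\neq v\in\mathbb{R}^n$, $\alpha(v)=\frac{\langle v,Av\rangle}{\langle Av,Av\rangle}$ and $\mathcal{I}_2(v)=(I-\alpha(v)A^T)(I-\alpha(v)A)$. A nonzero $u\in\mathbb{R}^n$ is an eigenvector with eigenvalue $\lambda$ if $\mathcal{I}_2(u)u=\lambda u$. "Definite" means positive definite or negative definite; "indefinite" means having both positive and negative eigenvalues.
   Formalization: In (b), "non-unit eigenvalues" is read as eigenvalues different from both 0 and 1; eigenvalue 0 must be excluded since, e.g., for A = diag(1,-1), u = e_1 is an eigenvector with eigenvalue 0 not of the form (∗). *)

theory Defs
  imports "HOL-Analysis.Analysis"
begin

definition mat_eigenvalue :: "real^'n^'n \<Rightarrow> real \<Rightarrow> bool" where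
  "mat_eigenvalue A l \<longleftrightarrow> (\<exists>v. v \<noteq> 0 \<and> A *v v = l *\<^sub>R v)"

definition positive_definite :: "real^'n^'n \<Rightarrow> bool" where
  "positive_definite A \<longleftrightarrow> (\<forall>v. v \<noteq> 0 \<longrightarrow> v \<bullet> (A *v v) > 0)"

definition negative_definite :: "real^'n^'n \<Rightarrow> bool" where
  "negative_definite A \<longleftrightarrow> (\<forall>v. v \<noteq> 0 \<longrightarrow> v \<bullet> (A *v v) < 0)"

definition definite :: "real^'n^'n \<Rightarrow> bool" where
  "definite A \<longleftrightarrow> positive_definite A \<or> negative_definite A"

definition indefinite :: "real^'n^'n \<Rightarrow> bool" where
  "indefinite A \<longleftrightarrow> (\<exists>l>0. mat_eigenvalue A l) \<and> (\<exists>l<0. mat_eigenvalue A l)"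

definition step_alpha :: "real^'n^'n \<Rightarrow> real^'n \<Rightarrow> real" where
  "step_alpha A v = (v \<bullet> (A *v v)) / ((A *v v) \<bullet> (A *v v))"

definition I2 :: "real^'n^'n \<Rightarrow> real^'n \<Rightarrow> real^'n^'n" where
  "I2 A v = (mat 1 - step_alpha A v *\<^sub>R transpose A) ** (mat 1 - step_alpha A v *\<^sub>R A)"

definition nl_eigenvector :: "real^'n^'n \<Rightarrow> real \<Rightarrow> real^'n \<Rightarrow> bool" where
  "nl_eigenvector A l u \<longleftrightarrow> u \<noteq> 0 \<and> I2 A u *v u = l *\<^sub>R u"

text \<open>
  The distinct eigenvalues of \<open>A\<close> are \<open>a 1, ..., a p\<close>; for each \<open>i\<close> the vectors
  \<open>e i 1, ..., e i (m i)\<close> are orthonormal eigenvectors for \<open>a i\<close>.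
  Values of \<open>a\<close>, \<open>m\<close> and \<open>e\<close> outside these ranges are irrelevant.
\<close>
definition eigen_data ::
    "real^'n^'n \<Rightarrow> nat \<Rightarrow> (nat \<Rightarrow> real) \<Rightarrow> (nat \<Rightarrow> nat) \<Rightarrow> (nat \<Rightarrow> nat \<Rightarrow> real^'n) \<Rightarrow> bool" where
  "eigen_data A p a m e \<longleftrightarrow>
     inj_on a {1..p} \<and>
     a ` {1..p} = {l. mat_eigenvalue A l} \<and>
     (\<forall>i\<in>{1..p}. \<forall>s\<in>{1..m i}. A *v e i s = a i *\<^sub>R e i s) \<and>
     (\<forall>i\<in>{1..p}. \<forall>s\<in>{1..m i}. \<forall>t\<in>{1..m i}. e i s \<bullet> e i t = (if s = t then 1 else 0)) \<and>
     (\<Sum>i=1..p. m i) = CARD('n)"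

definition two_eigenspace_form ::
    "nat \<Rightarrow> (nat \<Rightarrow> real) \<Rightarrow> (nat \<Rightarrow> nat) \<Rightarrow> (nat \<Rightarrow> nat \<Rightarrow> real^'n) \<Rightarrow> real^'n \<Rightarrow> bool" where
  "two_eigenspace_form p a m e u \<longleftrightarrow>
     (\<exists>i\<in>{1..p}. \<exists>j\<in>{1..p}. \<exists>c d :: nat \<Rightarrow> real.
        i \<noteq> j \<and>
        u = (\<Sum>s=1..m i. c s *\<^sub>R e i s) + (\<Sum>r=1..m j. d r *\<^sub>R e j r) \<and>
        (\<exists>s\<in>{1..m i}. c s \<noteq> 0) \<and>
        (\<exists>r\<in>{1..m j}. d r \<noteq> 0) \<and>
        (\<Sum>r=1..m j. (d r)\<^sup>2) / (\<Sum>s=1..m i. (c s)\<^sup>2) = a i / a j \<and>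
        a i / a j > 0)"

end

theory Submission
  imports Defs
begin

text \<open>
  For symmetric \<open>A\<close> put \<open>\<alpha> = step_alpha A u\<close> and \<open>B = I - \<alpha>A\<close>, so that the problem reads
  \<open>B(Bu) = \<lambda>u\<close>. Then \<open>\<lambda>\<langle>u,u\<rangle> = \<langle>Bu,Bu\<rangle> \<ge> 0\<close>, and for \<open>\<lambda> \<noteq> 0\<close> with \<open>\<mu> = sqrt \<lambda>\<close>
  the factorization \<open>(B - \<mu>)(B + \<mu>)u = 0\<close> splits \<open>u\<close> into a \<open>\<mu>\<close>-part and a \<open>(-\<mu>)\<close>-part
  for \<open>B\<close>. If \<open>\<alpha> \<noteq> 0\<close>, these parts are eigenvectors of \<open>A\<close> for the distinct eigenvalues
  \<open>(1 - \<mu>)/\<alpha>\<close> and \<open>(1 + \<mu>)/\<alpha>\<close>. Neither part vanishes, because an eigenvector of \<open>A\<close> for \<open>a\<close>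
  has \<open>\<alpha> = 1/a\<close> and is annihilated by \<open>B\<close>.

  Conversely, let \<open>u = v + w\<close> with eigenvectors \<open>v\<close>, \<open>w\<close> for \<open>a \<noteq> b\<close>. Then \<open>u\<close> solves the problem
  exactly if \<open>(1 - \<alpha>a)\<^sup>2 = (1 - \<alpha>b)\<^sup>2\<close>, which for \<open>\<alpha> \<noteq> 0\<close> means \<open>\<alpha>(a + b) = 2\<close>. As \<open>v\<close> and \<open>w\<close> are
  orthogonal, \<open>\<alpha> = (a|v|\<^sup>2 + b|w|\<^sup>2)/(a\<^sup>2|v|\<^sup>2 + b\<^sup>2|w|\<^sup>2)\<close>, and the condition becomes
  \<open>a|v|\<^sup>2 = b|w|\<^sup>2\<close>. The eigenvalue is then \<open>((b - a)/(b + a))\<^sup>2\<close>, which is neither \<open>0\<close> (as \<open>a \<noteq> b\<close>) nor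
  \<open>1\<close> (as \<open>ab \<noteq> 0\<close>). So the balanced sums are the solutions with \<open>\<alpha> \<noteq> 0\<close> and \<open>\<lambda> \<noteq> 0\<close>
  (\<open>nl_eigenvector_imp_balanced\<close>, \<open>balanced_imp_nl_eigenvector\<close>), while \<open>\<alpha> = 0\<close> makes \<open>B\<close> the
  identity, so that \<open>\<lambda> = 1\<close>. Both parts of the theorem are this dichotomy: \<open>\<alpha>\<close> never vanishes when \<open>A\<close> is definite,
  and for invertible \<open>A\<close> it vanishes exactly when \<open>\<langle>Au,u\<rangle> = 0\<close>.

  What remains is to write eigenvectors in the given basis vectors. The family \<open>e\<close> is orthonormal
  and has as many members as the dimension, so it spans the space, and a vector of one eigenspace,
  being orthogonal to all others, is a combination of the \<open>e i s\<close> with fixed \<open>i\<close>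
  (\<open>eigenspace_expansion\<close>).
\<close>

definition balanced_eigen_sum :: "real^'n^'n \<Rightarrow> real^'n \<Rightarrow> bool" where
  "balanced_eigen_sum A u \<longleftrightarrow>
     (\<exists>a b v w. a \<noteq> b \<and> u = v + w \<and> v \<noteq> 0 \<and> w \<noteq> 0 \<and> A *v v = a *\<^sub>R v \<and> A *v w = b *\<^sub>R w \<and>
        a * (v \<bullet> v) = b * (w \<bullet> w))"

section \<open>Symmetric matrices\<close>

lemma symmetric_inner_swap:
  fixes A :: "real^'n^'n"
  assumes "transpose A = A"
  shows "(A *v x) \<bullet> y = x \<bullet> (A *v y)"
  by (metis assms dot_lmul_matrix transpose_matrix_vector)

lemma symmetric_eigenvectors_orthogonal:
  fixes A :: "real^'n^'n"
  assumes "transpose A = A" "A *v v = a *\<^sub>R v" "A *v w = b *\<^sub>R w" "a \<noteq> b"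
  shows "v \<bullet> w = 0"
  using symmetric_inner_swap[OF assms(1), of v w] assms(2-4) by simp

lemma invertible_mult_eq_0_iff:
  fixes A :: "real^'n^'n"
  assumes "invertible A"
  shows "A *v x = 0 \<longleftrightarrow> x = 0"
  using matrix_left_invertible_ker[of A] assms
  by (auto simp: invertible_def)

lemma invertible_eigenvalue_nonzero:
  fixes A :: "real^'n^'n"
  assumes "invertible A" "A *v v = a *\<^sub>R v" "v \<noteq> 0"
  shows "a \<noteq> 0"
  using invertible_mult_eq_0_iff[OF assms(1), of v] assms(2,3) by auto

lemma I2_mult_symmetric:
  fixes A :: "real^'n^'n"
  assumes "transpose A = A"
  shows "I2 A u *v x = (mat 1 - step_alpha A u *\<^sub>R A) *v ((mat 1 - step_alpha A u *\<^sub>R A) *v x)"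
  using assms by (simp add: I2_def matrix_vector_mul_assoc)

lemma shifted_mult:
  fixes A :: "real^'n^'n"
  shows "(mat 1 - c *\<^sub>R A) *v x = x - c *\<^sub>R (A *v x)"
  by (simp add: matrix_vector_mult_diff_rdistrib scaleR_matrix_vector_assoc)

section \<open>Solutions as balanced sums of two eigenvectors\<close>

lemma step_alpha_eigenvector:
  assumes "A *v u = a *\<^sub>R u" "u \<noteq> 0"
  shows "step_alpha A u = 1 / a"
  using assms by (simp add: step_alpha_def)

text \<open>
  The step length \<open>1/a\<close> of an eigenvector of \<open>A\<close> is chosen so that one step lands on zero.
\<close>

lemma eigenvector_nl_eigenvalue_zero:
  fixes A :: "real^'n^'n"
  assumes "transpose A = A" "A *v u = a *\<^sub>R u" "a \<noteq> 0" "nl_eigenvector A l u"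
  shows "l = 0"
proof -
  have u: "u \<noteq> 0" "I2 A u *v u = l *\<^sub>R u" using assms(4) by (auto simp: nl_eigenvector_def)
  have "(mat 1 - step_alpha A u *\<^sub>R A) *v u = 0"
    using assms(2,3) u(1) by (simp add: shifted_mult step_alpha_eigenvector)
  then have "I2 A u *v u = 0" by (simp add: I2_mult_symmetric assms(1))
  with u show ?thesis by simp
qed

text \<open>
  On a sum of eigenvectors for \<open>a \<noteq> b\<close> with \<open>\<alpha> = step_alpha A (v + w)\<close> nonzero, the eigenvalue
  condition \<open>(1 - \<alpha>a)\<^sup>2 = (1 - \<alpha>b)\<^sup>2\<close> is \<open>\<alpha>(a + b) = 2\<close>; substituting the value of \<open>\<alpha>\<close> and cancelling
  \<open>a - b\<close> turns this into the balance of \<open>a|v|\<^sup>2\<close> and \<open>b|w|\<^sup>2\<close>.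
\<close>

lemma step_alpha_sum_iff_balanced:
  fixes A :: "real^'n^'n"
  assumes "transpose A = A" "A *v v = a *\<^sub>R v" "A *v w = b *\<^sub>R w" "a \<noteq> b"
    and "A *v (v + w) \<noteq> 0"
  shows "step_alpha A (v + w) * (a + b) = 2 \<longleftrightarrow> a * (v \<bullet> v) = b * (w \<bullet> w)"
proof -
  have o: "v \<bullet> w = 0" "w \<bullet> v = 0"
    using symmetric_eigenvectors_orthogonal[OF assms(1-4)] by (auto simp: inner_commute)
  have Au: "A *v (v + w) = a *\<^sub>R v + b *\<^sub>R w"
    using assms by (simp add: matrix_vector_right_distrib)
  define x y where xy: "x = v \<bullet> v" "y = w \<bullet> w"
  have num: "(v + w) \<bullet> (A *v (v + w)) = a * x + b * y"
    unfolding Au xy by (simp add: inner_simps o)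
  have den: "(A *v (v + w)) \<bullet> (A *v (v + w)) = a\<^sup>2 * x + b\<^sup>2 * y"
    unfolding Au xy by (simp add: inner_simps o power2_eq_square)
  have nz: "a\<^sup>2 * x + b\<^sup>2 * y \<noteq> 0"
    using assms(5) den by (metis inner_eq_zero_iff)
  have "step_alpha A (v + w) * (a + b) = 2 \<longleftrightarrow> (a * x + b * y) * (a + b) = 2 * (a\<^sup>2 * x + b\<^sup>2 * y)"
    unfolding step_alpha_def num den using nz by (simp add: divide_simps)
  also have "\<dots> \<longleftrightarrow> (b - a) * (a * x - b * y) = 0"
    by (auto simp: algebra_simps power2_eq_square)
  finally show ?thesis using assms(4) by (simp add: xy)
qed

lemma nl_eigenvector_imp_balanced:
  fixes A :: "real^'n^'n"
  assumes inv: "invertible A" and sym: "transpose A = A"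
    and nl: "nl_eigenvector A l u" and l: "l \<noteq> 0" and alpha: "step_alpha A u \<noteq> 0"
  shows "balanced_eigen_sum A u"
proof -
  define c where "c = step_alpha A u"
  define B where "B = mat 1 - c *\<^sub>R A"
  have u: "u \<noteq> 0" and BB: "B *v (B *v u) = l *\<^sub>R u"
    using nl by (auto simp: nl_eigenvector_def I2_mult_symmetric[OF sym] B_def c_def)
  have c0: "c \<noteq> 0" using alpha by (simp add: c_def)
  have symB: "transpose B = B"
    using sym by (simp add: B_def transpose_def vec_eq_iff mat_def)
  have "l * (u \<bullet> u) = (B *v u) \<bullet> (B *v u)"
    using symmetric_inner_swap[OF symB, of u "B *v u"] BB by (simp add: inner_commute)
  moreover have "u \<bullet> u > 0" using u by simp
  ultimately have "l > 0"
    using l by (metis inner_ge_zero linorder_neqE_linordered_idom mult_neg_pos not_less)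
  define r where "r = sqrt l"
  have r: "r > 0" "l = r * r" using \<open>l > 0\<close> by (auto simp: r_def)
  \<comment> \<open>The splitting coming from \<open>(B - r)(B + r)u = 0\<close>, scaled so that the two parts sum to \<open>u\<close>.\<close>
  define v where "v = (1 / (2 * r)) *\<^sub>R (B *v u + r *\<^sub>R u)"
  define w where "w = (1 / (2 * r)) *\<^sub>R (r *\<^sub>R u - B *v u)"
  have uvw: "u = v + w"
    using r by (simp add: v_def w_def scaleR_add_right[symmetric] scaleR_2[symmetric])
  have Bv: "B *v v = r *\<^sub>R v"
    using r by (simp add: v_def matrix_vector_mult_scaleR matrix_vector_right_distrib BB algebra_simps)
  have Bw: "B *v w = (- r) *\<^sub>R w"
    using r by (simp add: w_def matrix_vector_mult_scaleR matrix_vector_mult_diff_distrib BB algebra_simps)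
  have AB: "A *v x = (1 / c) *\<^sub>R (x - B *v x)" for x
    using c0 by (simp add: B_def shifted_mult)
  have Av: "A *v v = ((1 - r) / c) *\<^sub>R v"
    unfolding AB Bv by (simp add: algebra_simps diff_divide_distrib)
  have Aw: "A *v w = ((1 + r) / c) *\<^sub>R w"
    unfolding AB Bw by (simp add: algebra_simps add_divide_distrib)
  have ab: "(1 - r) / c \<noteq> (1 + r) / c" using r c0 by (simp add: divide_simps)
  have not_eigen: "A *v u \<noteq> k *\<^sub>R u" for k
    using eigenvector_nl_eigenvalue_zero[OF sym _ _ nl, of k]
      invertible_eigenvalue_nonzero[OF inv _ u, of k] l by blast
  have "v \<noteq> 0" using not_eigen uvw Aw by force
  moreover have "w \<noteq> 0" using not_eigen uvw Av by force
  moreover have "(1 - r) / c * (v \<bullet> v) = (1 + r) / c * (w \<bullet> w)"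
  proof (subst step_alpha_sum_iff_balanced[OF sym Av Aw ab, symmetric])
    show "A *v (v + w) \<noteq> 0"
      using invertible_mult_eq_0_iff[OF inv] u uvw by simp
    show "step_alpha A (v + w) * ((1 - r) / c + (1 + r) / c) = 2"
      using c0 by (simp add: uvw[symmetric] c_def[symmetric] field_simps)
  qed
  ultimately show ?thesis
    unfolding balanced_eigen_sum_def using ab uvw Av Aw by blast
qed

lemma balanced_imp_nl_eigenvector:
  fixes A :: "real^'n^'n"
  assumes inv: "invertible A" and sym: "transpose A = A" and bal: "balanced_eigen_sum A u"
  shows "step_alpha A u \<noteq> 0 \<and> (\<exists>l. l \<noteq> 0 \<and> l \<noteq> 1 \<and> nl_eigenvector A l u)"
proof -
  obtain a b v w where ab: "a \<noteq> b" and uvw: "u = v + w" and v: "v \<noteq> 0" and w: "w \<noteq> 0"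
    and Av: "A *v v = a *\<^sub>R v" and Aw: "A *v w = b *\<^sub>R w" and bal: "a * (v \<bullet> v) = b * (w \<bullet> w)"
    using bal by (auto simp: balanced_eigen_sum_def)
  have "v \<bullet> w = 0" by (rule symmetric_eigenvectors_orthogonal[OF sym Av Aw ab])
  then have "u \<bullet> v \<noteq> 0" using v by (simp add: uvw inner_simps inner_commute)
  then have u: "u \<noteq> 0" by auto
  define c where "c = step_alpha A u"
  have ca: "c * (a + b) = 2"
    using step_alpha_sum_iff_balanced[OF sym Av Aw ab] bal u invertible_mult_eq_0_iff[OF inv]
    by (simp add: c_def uvw)
  have c0: "c \<noteq> 0" using ca by auto
  have a0: "a \<noteq> 0" and b0: "b \<noteq> 0"
    using invertible_eigenvalue_nonzero[OF inv] Av Aw v w by blast+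
  define r where "r = 1 - c * a"
  have r': "1 - c * b = - r" using ca by (simp add: r_def algebra_simps)
  have "r \<noteq> 0"
  proof
    assume "r = 0"
    then have "c * a = c * b" using r' by (simp add: r_def)
    then show False using c0 ab by simp
  qed
  moreover have "r \<noteq> 1" using c0 a0 by (simp add: r_def)
  moreover have "r \<noteq> -1" using c0 b0 r' by auto
  moreover have "nl_eigenvector A (r\<^sup>2) u"
  proof -
    define B where "B = mat 1 - c *\<^sub>R A"
    have Bv: "B *v v = r *\<^sub>R v"
      unfolding B_def shifted_mult Av by (simp add: r_def algebra_simps)
    have "B *v w = (1 - c * b) *\<^sub>R w"
      unfolding B_def shifted_mult Aw by (simp add: algebra_simps)
    then have Bw: "B *v w = (- r) *\<^sub>R w" by (simp only: r')
    have "B *v (B *v u) = r\<^sup>2 *\<^sub>R u"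
      unfolding uvw matrix_vector_right_distrib Bv Bw matrix_vector_mult_scaleR
      by (simp add: power2_eq_square algebra_simps)
    then show ?thesis
      using u by (simp add: nl_eigenvector_def I2_mult_symmetric[OF sym] B_def c_def)
  qed
  ultimately show ?thesis
    using c0 c_def by (metis power2_eq_1_iff power_eq_0_iff)
qed

lemma step_alpha_zero_imp_nl_eigenvector:
  fixes A :: "real^'n^'n"
  assumes "u \<noteq> 0" "step_alpha A u = 0"
  shows "nl_eigenvector A 1 u"
  using assms by (simp add: nl_eigenvector_def I2_def)

lemma nl_eigenvalue_unique:
  assumes "nl_eigenvector A l u" "nl_eigenvector A k u"
  shows "l = k"
  using assms by (auto simp: nl_eigenvector_def)

lemma step_alpha_eq_0_iff:
  fixes A :: "real^'n^'n"
  assumes "invertible A" "u \<noteq> 0"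
  shows "step_alpha A u = 0 \<longleftrightarrow> (A *v u) \<bullet> u = 0"
  using invertible_mult_eq_0_iff[OF assms(1), of u] assms(2)
  by (simp add: step_alpha_def inner_commute)

section \<open>Coordinates in an orthonormal eigenbasis\<close>

lemma eigen_data_eigenvalues_distinct:
  assumes "eigen_data A p a m e" "i \<in> {1..p}" "j \<in> {1..p}" "i \<noteq> j"
  shows "a i \<noteq> a j"
  using assms unfolding eigen_data_def by (meson inj_onD)

lemma eigen_data_eigenvector:
  assumes "eigen_data A p a m e" "i \<in> {1..p}" "s \<in> {1..m i}"
  shows "A *v e i s = a i *\<^sub>R e i s"
  using assms unfolding eigen_data_def by blast

lemma eigen_data_orthonormal:
  fixes A :: "real^'n^'n"
  assumes sym: "transpose A = A" and ed: "eigen_data A p a m e"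
    and "i \<in> {1..p}" "s \<in> {1..m i}" "j \<in> {1..p}" "t \<in> {1..m j}"
  shows "e i s \<bullet> e j t = (if i = j \<and> s = t then 1 else 0)"
proof (cases "i = j")
  case True
  moreover have "e i s \<bullet> e i t = (if s = t then 1 else 0)" if "t \<in> {1..m i}"
    using ed assms(3,4) that unfolding eigen_data_def by blast
  ultimately show ?thesis using assms(6) by simp
next
  case False
  then have "a i \<noteq> a j" by (intro eigen_data_eigenvalues_distinct[OF ed] assms)
  then show ?thesis
    using symmetric_eigenvectors_orthogonal[OF sym eigen_data_eigenvector[OF ed assms(3,4)]
        eigen_data_eigenvector[OF ed assms(5,6)]] False by simp
qed

text \<open>
  Orthonormality makes the family injective and independent, and the multiplicities add up to the
  dimension.
\<close>

lemma eigen_data_span: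
  fixes A :: "real^'n^'n"
  assumes sym: "transpose A = A" and ed: "eigen_data A p a m e"
  shows "span ((\<lambda>(i, s). e i s) ` (SIGMA i:{1..p}. {1..m i})) = UNIV"
proof -
  define I where "I = (SIGMA i:{1..p}. {1..m i})"
  define f where "f = (\<lambda>(i, s). e i s)"
  have on: "f x \<bullet> f y = (if x = y then 1 else 0)" if "x \<in> I" "y \<in> I" for x y
  proof (cases x, cases y)
    fix i s j t assume "x = (i, s)" "y = (j, t)"
    then show ?thesis
      using that eigen_data_orthonormal[OF sym ed, of i s j t] by (simp add: I_def f_def)
  qed
  have inj: "inj_on f I"
    by (rule inj_onI) (metis on zero_neq_one)
  have "card I = CARD('n)"
    using ed by (simp add: I_def eigen_data_def)
  then have "card (f ` I) = CARD('n)"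
    by (simp add: card_image[OF inj])
  moreover have "independent (f ` I)"
  proof (rule pairwise_orthogonal_independent)
    show "pairwise orthogonal (f ` I)"
      using on by (fastforce simp: pairwise_def orthogonal_def)
    show "0 \<notin> f ` I"
      using on by (metis imageE inner_zero_left zero_neq_one)
  qed
  moreover have "finite (f ` I)" by (simp add: I_def)
  ultimately have "UNIV \<subseteq> span (f ` I)"
    by (intro card_ge_dim_independent) (auto simp: dim_UNIV)
  then show ?thesis by (auto simp: I_def f_def)
qed

text \<open>
  The difference between \<open>v\<close> and its projection is orthogonal to the whole spanning family: to the
  \<open>e i s\<close> by construction, to the others because they belong to different eigenvalues.
\<close>

lemma eigenspace_expansion:
  fixes A :: "real^'n^'n"
  assumes sym: "transpose A = A" and ed: "eigen_data A p a m e"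
    and i: "i \<in> {1..p}" and v: "A *v v = a i *\<^sub>R v"
  shows "v = (\<Sum>s=1..m i. (v \<bullet> e i s) *\<^sub>R e i s)"
proof -
  define x where "x = v - (\<Sum>s=1..m i. (v \<bullet> e i s) *\<^sub>R e i s)"
  have "x \<bullet> e j t = 0" if j: "j \<in> {1..p}" and t: "t \<in> {1..m j}" for j t
  proof (cases "j = i")
    case True
    have "(\<Sum>s=1..m i. (v \<bullet> e i s) *\<^sub>R e i s) \<bullet> e i t =
        (\<Sum>s=1..m i. (v \<bullet> e i s) * (if s = t then 1 else 0))"
      unfolding inner_sum_left inner_scaleR_left
      using eigen_data_orthonormal[OF sym ed i _ i] t True by (intro sum.cong) auto
    also have "\<dots> = v \<bullet> e i t" using t True by (simp add: if_distrib cong: if_cong)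
    finally show ?thesis using True by (simp add: x_def inner_diff_left)
  next
    case False
    then have "a i \<noteq> a j" by (metis eigen_data_eigenvalues_distinct[OF ed i j])
    then have "v \<bullet> e j t = 0"
      using symmetric_eigenvectors_orthogonal[OF sym v eigen_data_eigenvector[OF ed j t]] by blast
    moreover have "(\<Sum>s=1..m i. (v \<bullet> e i s) *\<^sub>R e i s) \<bullet> e j t = 0"
      unfolding inner_sum_left inner_scaleR_left
      using eigen_data_orthonormal[OF sym ed i _ j t] False by (intro sum.neutral) auto
    ultimately show ?thesis by (simp add: x_def inner_diff_left)
  qed
  then have "orthogonal x y" if "y \<in> (\<lambda>(i, s). e i s) ` (SIGMA i:{1..p}. {1..m i})" for y
    using that by (auto simp: orthogonal_def)
  then have "orthogonal x x"
    using orthogonal_to_span[of x "(\<lambda>(i, s). e i s) ` (SIGMA i:{1..p}. {1..m i})" x]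
      eigen_data_span[OF sym ed] by auto
  then show ?thesis by (simp add: orthogonal_def x_def)
qed

lemma eigenspace_sum:
  fixes A :: "real^'n^'n"
  assumes ed: "eigen_data A p a m e" and i: "i \<in> {1..p}"
  shows "A *v (\<Sum>s=1..m i. c s *\<^sub>R e i s) = a i *\<^sub>R (\<Sum>s=1..m i. c s *\<^sub>R e i s)"
    and "(\<Sum>s=1..m i. c s *\<^sub>R e i s) \<bullet> (\<Sum>s=1..m i. c s *\<^sub>R e i s) = (\<Sum>s=1..m i. (c s)\<^sup>2)"
proof -
  have "A *v (\<Sum>s=1..m i. c s *\<^sub>R e i s) = (\<Sum>s=1..m i. A *v (c s *\<^sub>R e i s))"
    by (simp add: linear_sum[OF matrix_vector_mul_linear])
  also have "\<dots> = (\<Sum>s=1..m i. a i *\<^sub>R c s *\<^sub>R e i s)"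
    using eigen_data_eigenvector[OF ed i] by (intro sum.cong) (auto simp: matrix_vector_mult_scaleR)
  finally show "A *v (\<Sum>s=1..m i. c s *\<^sub>R e i s) = a i *\<^sub>R (\<Sum>s=1..m i. c s *\<^sub>R e i s)"
    by (simp add: scaleR_sum_right)
  have orth: "e i s \<bullet> e i t = (if s = t then 1 else 0)" if "s \<in> {1..m i}" "t \<in> {1..m i}" for s t
    using ed i that unfolding eigen_data_def by blast
  have "(\<Sum>s=1..m i. c s *\<^sub>R e i s) \<bullet> (\<Sum>s=1..m i. c s *\<^sub>R e i s) =
      (\<Sum>s=1..m i. \<Sum>t=1..m i. c s * (c t * (e i s \<bullet> e i t)))"
    unfolding inner_sum_left inner_scaleR_left
    unfolding inner_sum_right inner_scaleR_right sum_distrib_left ..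
  also have "\<dots> = (\<Sum>s=1..m i. \<Sum>t=1..m i. if s = t then (c s)\<^sup>2 else 0)"
    using orth by (intro sum.cong refl) (simp add: power2_eq_square)
  also have "\<dots> = (\<Sum>s=1..m i. (c s)\<^sup>2)" by simp
  finally show "(\<Sum>s=1..m i. c s *\<^sub>R e i s) \<bullet> (\<Sum>s=1..m i. c s *\<^sub>R e i s) = (\<Sum>s=1..m i. (c s)\<^sup>2)" .
qed

lemma eigenspace_sum_nonzero_iff:
  fixes A :: "real^'n^'n"
  assumes "eigen_data A p a m e" "i \<in> {1..p}"
  shows "(\<Sum>s=1..m i. c s *\<^sub>R e i s) \<noteq> 0 \<longleftrightarrow> (\<exists>s\<in>{1..m i}. c s \<noteq> 0)"
proof -
  have "(\<Sum>s=1..m i. c s *\<^sub>R e i s) = 0 \<longleftrightarrow> (\<Sum>s=1..m i. (c s)\<^sup>2) = 0"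
    by (simp only: eigenspace_sum(2)[OF assms, symmetric] inner_eq_zero_iff)
  then show ?thesis by (simp add: sum_nonneg_eq_0_iff)
qed

text \<open>
  This is applied with \<open>x = |v|\<^sup>2\<close> and \<open>y = |w|\<^sup>2\<close>. In the backward direction \<open>a/b\<close> is positive
  because it equals the quotient \<open>y/x\<close> of positive numbers.
\<close>

lemma ratio_iff_balanced:
  fixes a b x y :: real
  assumes "x > 0" "y > 0" "b \<noteq> 0"
  shows "y / x = a / b \<and> a / b > 0 \<longleftrightarrow> a * x = b * y"
proof -
  have "y / x = a / b \<longleftrightarrow> a * x = b * y"
    using assms by (auto simp: divide_simps mult.commute)
  moreover have "y / x > 0" using assms by simp
  ultimately show ?thesis by auto
qed

lemma two_eigenspace_form_iff_balanced:
  fixes A :: "real^'n^'n"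
  assumes inv: "invertible A" and sym: "transpose A = A" and ed: "eigen_data A p a m e"
  shows "two_eigenspace_form p a m e u \<longleftrightarrow> balanced_eigen_sum A u"
proof
  assume "two_eigenspace_form p a m e u"
  then obtain i j c d where i: "i \<in> {1..p}" and j: "j \<in> {1..p}" and ij: "i \<noteq> j"
    and u: "u = (\<Sum>s=1..m i. c s *\<^sub>R e i s) + (\<Sum>r=1..m j. d r *\<^sub>R e j r)"
    and c: "\<exists>s\<in>{1..m i}. c s \<noteq> 0" and d: "\<exists>r\<in>{1..m j}. d r \<noteq> 0"
    and q: "(\<Sum>r=1..m j. (d r)\<^sup>2) / (\<Sum>s=1..m i. (c s)\<^sup>2) = a i / a j" "a i / a j > 0"
    unfolding two_eigenspace_form_def by blast
  define v where "v = (\<Sum>s=1..m i. c s *\<^sub>R e i s)"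
  define w where "w = (\<Sum>r=1..m j. d r *\<^sub>R e j r)"
  have nz: "v \<noteq> 0" "w \<noteq> 0"
    using eigenspace_sum_nonzero_iff[OF ed i] eigenspace_sum_nonzero_iff[OF ed j] c d
    by (auto simp: v_def w_def)
  have eig: "A *v v = a i *\<^sub>R v" "A *v w = a j *\<^sub>R w"
    unfolding v_def w_def by (rule eigenspace_sum(1)[OF ed] i j)+
  have "(w \<bullet> w) / (v \<bullet> v) = a i / a j"
    using q(1) eigenspace_sum(2)[OF ed i, of c] eigenspace_sum(2)[OF ed j, of d]
    by (simp add: v_def w_def)
  then have "a i * (v \<bullet> v) = a j * (w \<bullet> w)"
    using ratio_iff_balanced[of "v \<bullet> v" "w \<bullet> w" "a j" "a i"] nz q(2) by force
  moreover have "a i \<noteq> a j" by (rule eigen_data_eigenvalues_distinct[OF ed i j ij])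
  moreover have "u = v + w" by (simp add: u v_def w_def)
  ultimately show "balanced_eigen_sum A u"
    unfolding balanced_eigen_sum_def using nz eig by blast
next
  assume "balanced_eigen_sum A u"
  then obtain k l v w where kl: "k \<noteq> l" and u: "u = v + w" and nz: "v \<noteq> 0" "w \<noteq> 0"
    and Av: "A *v v = k *\<^sub>R v" and Aw: "A *v w = l *\<^sub>R w" and bal: "k * (v \<bullet> v) = l * (w \<bullet> w)"
    by (auto simp: balanced_eigen_sum_def)
  have "k \<in> a ` {1..p}" "l \<in> a ` {1..p}"
    using Av Aw nz ed unfolding eigen_data_def mat_eigenvalue_def by blast+
  then obtain i j where i: "i \<in> {1..p}" "k = a i" and j: "j \<in> {1..p}" "l = a j" by blast
  have l0: "l \<noteq> 0" using invertible_eigenvalue_nonzero[OF inv Aw nz(2)] .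
  define c where "c s = v \<bullet> e i s" for s
  define d where "d r = w \<bullet> e j r" for r
  have v: "v = (\<Sum>s=1..m i. c s *\<^sub>R e i s)"
    using eigenspace_expansion[OF sym ed i(1), of v] Av by (simp add: c_def i(2))
  have w: "w = (\<Sum>r=1..m j. d r *\<^sub>R e j r)"
    using eigenspace_expansion[OF sym ed j(1), of w] Aw by (simp add: d_def j(2))
  have "v \<bullet> v = (\<Sum>s=1..m i. (c s)\<^sup>2)" "w \<bullet> w = (\<Sum>r=1..m j. (d r)\<^sup>2)"
    using eigenspace_sum(2)[OF ed i(1), of c] eigenspace_sum(2)[OF ed j(1), of d] v w by auto
  moreover have "(w \<bullet> w) / (v \<bullet> v) = k / l \<and> k / l > 0"
    using ratio_iff_balanced[of "v \<bullet> v" "w \<bullet> w" l k] nz l0 bal by auto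
  moreover have "\<exists>s\<in>{1..m i}. c s \<noteq> 0" "\<exists>r\<in>{1..m j}. d r \<noteq> 0"
    using eigenspace_sum_nonzero_iff[OF ed i(1), of c] eigenspace_sum_nonzero_iff[OF ed j(1), of d]
      nz v w by auto
  moreover have "i \<noteq> j" using kl i j by auto
  moreover have "u = (\<Sum>s=1..m i. c s *\<^sub>R e i s) + (\<Sum>r=1..m j. d r *\<^sub>R e j r)"
    using u v w by simp
  ultimately show "two_eigenspace_form p a m e u"
    unfolding two_eigenspace_form_def i(2) j(2)
    by (intro bexI[OF _ i(1)] bexI[OF _ j(1)] exI[of _ c] exI[of _ d] conjI) simp_all
qed

section \<open>The definite and the indefinite case\<close>

theorem theorem2p5:
  fixes A :: "real^'n^'n"
    and p :: nat
    and a :: "nat \<Rightarrow> real"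
    and m :: "nat \<Rightarrow> nat"
    and e :: "nat \<Rightarrow> nat \<Rightarrow> real^'n"
  assumes "invertible A"
    and "transpose A = A"
    and "eigen_data A p a m e"
  shows "(definite A \<longrightarrow>
           (\<forall>u. (\<exists>l. l \<noteq> 0 \<and> nl_eigenvector A l u) \<longleftrightarrow> two_eigenspace_form p a m e u)) \<and>
         (indefinite A \<longrightarrow>
           (\<forall>u. (\<exists>l. l \<noteq> 0 \<and> l \<noteq> 1 \<and> nl_eigenvector A l u) \<longleftrightarrow> two_eigenspace_form p a m e u) \<and>
           (\<forall>u. nl_eigenvector A 1 u \<longleftrightarrow> u \<noteq> 0 \<and> (A *v u) \<bullet> u = 0))"
proof -
  have form: "two_eigenspace_form p a m e u \<longleftrightarrow> balanced_eigen_sum A u" for u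
    by (rule two_eigenspace_form_iff_balanced[OF assms])
  have forward: "balanced_eigen_sum A u"
    if "nl_eigenvector A l u" "l \<noteq> 0" "step_alpha A u \<noteq> 0" for l u
    using nl_eigenvector_imp_balanced[OF assms(1,2)] that by blast
  have backward: "\<exists>l. l \<noteq> 0 \<and> l \<noteq> 1 \<and> nl_eigenvector A l u" if "balanced_eigen_sum A u" for u
    using balanced_imp_nl_eigenvector[OF assms(1,2)] that by blast
  have unit: "nl_eigenvector A 1 u \<longleftrightarrow> u \<noteq> 0 \<and> step_alpha A u = 0" for u
  proof
    assume nl: "nl_eigenvector A 1 u"
    then have "\<not> balanced_eigen_sum A u"
      using backward nl_eigenvalue_unique by blast
    then show "u \<noteq> 0 \<and> step_alpha A u = 0"
      using forward[OF nl] nl by (auto simp: nl_eigenvector_def)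
  qed (simp add: step_alpha_zero_imp_nl_eigenvector)
  have nonunit: "(\<exists>l. l \<noteq> 0 \<and> l \<noteq> 1 \<and> nl_eigenvector A l u) \<longleftrightarrow> balanced_eigen_sum A u" for u
  proof
    assume "\<exists>l. l \<noteq> 0 \<and> l \<noteq> 1 \<and> nl_eigenvector A l u"
    then obtain l where l: "l \<noteq> 0" "l \<noteq> 1" "nl_eigenvector A l u" by blast
    then have "\<not> nl_eigenvector A 1 u" using nl_eigenvalue_unique by blast
    then have "step_alpha A u \<noteq> 0" using unit l(3) unfolding nl_eigenvector_def by blast
    then show "balanced_eigen_sum A u" using forward l by blast
  qed (rule backward)
  have zero: "u \<noteq> 0 \<and> step_alpha A u = 0 \<longleftrightarrow> u \<noteq> 0 \<and> (A *v u) \<bullet> u = 0" for u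
    using step_alpha_eq_0_iff[OF assms(1)] by blast
  have "(\<exists>l. l \<noteq> 0 \<and> nl_eigenvector A l u) \<longleftrightarrow> balanced_eigen_sum A u" if "definite A" for u
  proof -
    have "\<not> nl_eigenvector A 1 u"
      unfolding unit zero using that
      by (auto simp: definite_def positive_definite_def negative_definite_def inner_commute)
    then show ?thesis using nonunit[of u] by metis
  qed
  then show ?thesis using form nonunit unit zero by simp
qed

end
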